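(* Let $m\ge 3$ be a prime, and let $D\subset\{0,1,\ldots,m-1\}$ with $0\in D$ and $1<\#D<m$. Suppose that $$\left(\frac{-a}{m}\right)_L=-1\quad\text{for all } a\in D\setminus\{0\}.$$ Then: (1) if $1\notin D$, then $\left\{\frac{1}{n^2}:n\in\mathbb{N}\right\}\cap K_{m,D}=\emptyset$; (2) if $1\in D$, then $\left\{\frac{1}{n^2}:n\in\mathbb{N}\right\}\cap K_{m,D}=\left\{\frac{1}{m^{2\ell}}:\ell\in\mathbb{N}\right\}$.
   Context: $\mathbb{N}$ is the set of positive integers and $\#D$ is the cardinality of $D$. For an integer $m\ge 3$ and $D\subset\{0,1,\ldots,m-1\}$ with $1<\#D<m$, define $$K_{m,D}=\left\{\sum_{k=1}^\infty\frac{d_k}{m^k}: d_k\in D\ \text{for all } k\in\mathbb{N}\right\}.$$ For an odd prime $p$ and an integer $a$ with $p\nmid a$, $\left(\frac{a}{p}\right)_L$ is the Legendre symbol: it equals $1$ if $x^2\equiv a\pmod p$ has a solution in $\{1,\ldots,p-1\}$, and $-1$ otherwise. *)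

theory Defs
  imports Complex_Main "HOL-Number_Theory.Number_Theory"
begin

text \<open>
  The digits are $d_1, d_2, \ldots$, so the value \<open>d 0\<close> is not used. The series is
  \<open>suminf\<close>, which converges for every digit sequence because the digit sets considered
  are finite subsets of \<open>{0..<m}\<close> with \<open>m \<ge> 3\<close>.
\<close>

definition K :: "nat \<Rightarrow> nat set \<Rightarrow> real set" where
  "K m D = {(\<Sum>k. real (d (Suc k)) / real m ^ Suc k) | d :: nat \<Rightarrow> nat. \<forall>k\<ge>1. d k \<in> D}"

end

theory Submission
  imports Defs
begin

text \<open>
  When \<open>m - 1\<close> is not a digit, every tail of an expansion is less than \<open>1\<close>, so the \<open>k\<close>-th digit
  of \<open>x\<close> is \<open>\<lfloor>m ^ k * x\<rfloor> mod m\<close>. Write \<open>n = m ^ j * q\<close> with \<open>m\<close> not dividing \<open>q\<close>.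
  If \<open>q > 1\<close>, pick \<open>t > 0\<close> with \<open>m ^ t = 1 + c * q\<^sup>2\<close>. Then \<open>m ^ (2 * j + t) / n\<^sup>2 = c + 1 / q\<^sup>2\<close>,
  so \<open>d = c mod m\<close> is a digit with \<open>d * q\<^sup>2 \<equiv> -1\<close>, whence \<open>-d \<equiv> (d * q)\<^sup>2\<close> is a nonzero square
  modulo \<open>m\<close>, which is excluded. If \<open>q = 1\<close>, the digit at position \<open>2 * j\<close> is \<open>1\<close>.
\<close>

definition digit_value :: "nat \<Rightarrow> (nat \<Rightarrow> nat) \<Rightarrow> real" where
  "digit_value m d = (\<Sum>k. real (d (Suc k)) / real m ^ Suc k)"

text \<open>Each digit is at most \<open>m - 2\<close>, so the series is dominated by a geometric
  series with sum \<open>(m - 2) / (m - 1)\<close>. The strict bound by \<open>1\<close> rules out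
  the ambiguity of base \<open>m\<close> expansions.\<close>

lemma digit_value_bounds:
  assumes m: "m \<ge> 2" and d: "\<forall>k\<ge>1. Suc (d k) < m"
  shows "summable (\<lambda>k. real (d (Suc k)) / real m ^ Suc k)"
    and "0 \<le> digit_value m d" and "digit_value m d < 1"
proof -
  let ?f = "\<lambda>k. real (d (Suc k)) / real m ^ Suc k"
  let ?g = "\<lambda>k. (real m - 2) / real m * (1 / real m) ^ k"
  have "(\<lambda>k. (1 / real m) ^ k) sums (1 / (1 - 1 / real m))"
    by (rule geometric_sums) (use m in auto)
  then have g: "?g sums ((real m - 2) / real m * (1 / (1 - 1 / real m)))"
    by (rule sums_mult)
  have le: "?f k \<le> ?g k" for k
  proof -
    have "real (d (Suc k)) \<le> real m - 2"
      using d[rule_format, of "Suc k"] by linarith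
    then show ?thesis
      using m by (simp add: field_simps)
  qed
  show f: "summable ?f"
    by (rule summable_comparison_test[OF _ sums_summable[OF g]]) (use le in auto)
  show "0 \<le> digit_value m d"
    unfolding digit_value_def by (rule suminf_nonneg[OF f]) simp
  have "digit_value m d \<le> (real m - 2) / real m * (1 / (1 - 1 / real m))"
    unfolding digit_value_def using suminf_le[OF le f sums_summable[OF g]] sums_unique[OF g]
    by simp
  also have "\<dots> < 1"
    using m by (simp add: field_simps)
  finally show "digit_value m d < 1" .
qed

lemma digit_value_Suc:
  assumes m: "m \<ge> 2" and d: "\<forall>k\<ge>1. Suc (d k) < m"
  shows "real m * digit_value m d = real (d 1) + digit_value m (\<lambda>k. d (Suc k))"
proof -
  let ?f = "\<lambda>k. real (d (Suc k)) / real m ^ Suc k"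
  note f = digit_value_bounds(1)[OF m d]
  have "digit_value m d = ?f 0 + (\<Sum>k. ?f (Suc k))"
    unfolding digit_value_def using suminf_split_head[OF f] by simp
  moreover have "real m * (\<Sum>k. ?f (Suc k)) = digit_value m (\<lambda>k. d (Suc k))"
    unfolding digit_value_def using m
    by (subst suminf_mult[symmetric, OF summable_Suc_iff[THEN iffD2, OF f]]) simp
  ultimately show ?thesis
    using m by (simp add: algebra_simps)
qed

text \<open>Each multiplication by \<open>m\<close> moves one digit in front of the radix point.
  Thus \<open>N\<close> is the integer with base \<open>m\<close> digits
  \<open>d 1, ..., d k\<close>, and its last digit is \<open>d k\<close>.\<close>

lemma digit_value_shift:
  assumes m: "m \<ge> 2" and d: "\<forall>k\<ge>1. Suc (d k) < m"
  obtains N :: nat where "real m ^ k * digit_value m d = real N + digit_value m (\<lambda>i. d (i + k))"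
    and "k = 0 \<Longrightarrow> N = 0" and "k \<ge> 1 \<Longrightarrow> N mod m = d k"
proof -
  have "\<exists>N::nat. real m ^ k * digit_value m d = real N + digit_value m (\<lambda>i. d (i + k))
      \<and> (k = 0 \<longrightarrow> N = 0) \<and> (k \<ge> 1 \<longrightarrow> N mod m = d k)"
  proof (induction k)
    case (Suc k)
    then obtain N :: nat
      where N: "real m ^ k * digit_value m d = real N + digit_value m (\<lambda>i. d (i + k))"
      by blast
    have "real m * digit_value m (\<lambda>i. d (i + k))
        = real (d (Suc k)) + digit_value m (\<lambda>i. d (i + Suc k))"
      using digit_value_Suc[of m "\<lambda>i. d (i + k)"] m d by simp
    then have "real m ^ Suc k * digit_value m d
        = real (m * N + d (Suc k)) + digit_value m (\<lambda>i. d (i + Suc k))"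
      using N by (simp add: algebra_simps)
    moreover have "(m * N + d (Suc k)) mod m = d (Suc k)"
      using d[rule_format, of "Suc k"] by simp
    ultimately show ?case by blast
  qed simp
  then show ?thesis using that by blast
qed

text \<open>Both \<open>r\<close> and the shifted tail lie in \<open>[0, 1)\<close>, so
  \<open>a\<close> and the integer \<open>N\<close> of the shift are the same integer part.\<close>

lemma digit_eq_mod:
  assumes m: "m \<ge> 2" and d: "\<forall>k\<ge>1. Suc (d k) < m"
    and eq: "real m ^ k * digit_value m d = real a + r" and r: "0 \<le> r" "r < 1"
  shows "k = 0 \<Longrightarrow> a = 0" and "k \<ge> 1 \<Longrightarrow> a mod m = d k"
proof -
  obtain N :: nat where N: "real m ^ k * digit_value m d = real N + digit_value m (\<lambda>i. d (i + k))"
    "k = 0 \<Longrightarrow> N = 0" "k \<ge> 1 \<Longrightarrow> N mod m = d k"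
    using digit_value_shift[OF m d] by blast
  have "0 \<le> digit_value m (\<lambda>i. d (i + k))" "digit_value m (\<lambda>i. d (i + k)) < 1"
    using digit_value_bounds[of m "\<lambda>i. d (i + k)"] m d by simp_all
  then have "a = N"
    using N(1) eq r by linarith
  then show "k = 0 \<Longrightarrow> a = 0" "k \<ge> 1 \<Longrightarrow> a mod m = d k"
    using N by auto
qed

lemma inverse_square_digit_value:
  assumes m: "prime m" and n: "n \<ge> 1"
    and d: "\<forall>k\<ge>1. Suc (d k) < m"
    and nonres: "\<And>k. k \<ge> 1 \<Longrightarrow> d k \<noteq> 0 \<Longrightarrow> \<not> QuadRes (int m) (- int (d k))"
    and eq: "1 / (real n)\<^sup>2 = digit_value m d"
  obtains j where "j \<ge> 1" "n = m ^ j" "d (2 * j) = 1"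
proof -
  have m2: "m \<ge> 2"
    using m by (rule prime_ge_2_nat)
  obtain j q where n_eq: "n = m ^ j * q" and q: "\<not> m dvd q"
    using prime_power_canonical[OF m, of n] n by (auto simp: mult.commute)
  have q0: "q > 0"
    using q by (cases q) auto
  \<comment> \<open>The factor \<open>m ^ (2 * j)\<close> cancels the power of \<open>m\<close> in
    \<open>n\<^sup>2\<close>.\<close>
  have scaled: "real m ^ (2 * j + t) * digit_value m d = real m ^ t / (real q)\<^sup>2" for t
    using m2 unfolding eq[symmetric] n_eq
    by (simp add: power_mult_distrib power_add power_mult[symmetric] mult.commute)
  show ?thesis
  proof (cases "q = 1")
    case True
    then have "real m ^ (2 * j) * digit_value m d = real 1 + 0"
      using scaled[of 0] by simp
    \<comment> \<open>For \<open>j = 0\<close> the integer part before any shift would be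
      \<open>0\<close>, but here it is \<open>1\<close>; this excludes \<open>n = 1\<close>.\<close>
    from digit_eq_mod[OF m2 d this] have "j \<noteq> 0" "j \<ge> 1 \<Longrightarrow> 1 mod m = d (2 * j)"
      by auto
    then have "j \<ge> 1" "d (2 * j) = 1"
      using m2 by simp_all
    moreover have "n = m ^ j"
      using n_eq True by simp
    ultimately show ?thesis
      using that by blast
  next
    case False
    \<comment> \<open>Euler's theorem makes this exponent give \<open>m ^ t \<equiv> 1\<close>
      modulo \<open>q\<^sup>2\<close>.\<close>
    define t where "t = totient (q\<^sup>2)"
    have "coprime m (q\<^sup>2)"
      using m q by (simp add: prime_imp_coprime)
    then have cong: "[m ^ t = 1] (mod q\<^sup>2)"
      unfolding t_def by (rule euler_theorem)
    have t: "t > 0"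
      unfolding t_def using q0 by simp
    have "q\<^sup>2 dvd m ^ t - 1"
      using cong m2 by (subst (asm) cong_altdef_nat) auto
    then obtain c where "m ^ t - 1 = q\<^sup>2 * c" ..
    moreover have "m ^ t \<ge> 1"
      using m2 by simp
    ultimately have c: "m ^ t = 1 + q\<^sup>2 * c"
      by linarith
    have "real m ^ t = 1 + (real q)\<^sup>2 * real c"
      using arg_cong[OF c, of real] by simp
    then have "real m ^ (2 * j + t) * digit_value m d = real c + 1 / (real q)\<^sup>2"
      using scaled[of t] q0 by (simp add: field_simps)
    \<comment> \<open>Since \<open>q \<ge> 2\<close>, this is a genuine fractional part and
      \<open>c\<close> is the integer part.\<close>
    moreover have "1 / (real q)\<^sup>2 < 1"
      using False q0 by (simp add: power2_eq_square less_1_mult)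
    ultimately have dc: "c mod m = d (2 * j + t)"
      using digit_eq_mod(2)[OF m2 d, of "2 * j + t" c "1 / (real q)\<^sup>2"] t by simp
    define e where "e = int (d (2 * j + t))"
    have "[e = int c] (mod int m)"
      unfolding e_def dc[symmetric] by (simp add: cong_def zmod_int)
    then have "[1 + (int q)\<^sup>2 * e = 1 + (int q)\<^sup>2 * int c] (mod int m)"
      by (intro cong_add cong_mult cong_refl)
    also have "1 + (int q)\<^sup>2 * int c = int m ^ t"
      using arg_cong[OF c, of int] by simp
    also have "[int m ^ t = 0] (mod int m)"
      using t by (simp add: cong_0_iff)
    finally have dvd: "int m dvd 1 + (int q)\<^sup>2 * e"
      by (simp add: cong_0_iff)
    then have "e \<noteq> 0"
      using m2 by auto
    \<comment> \<open>Multiplying \<open>1 + q\<^sup>2 * e \<equiv> 0\<close> by \<open>e\<close>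
      completes a square: \<open>-e \<equiv> (e * q)\<^sup>2\<close>.\<close>
    have "int m dvd e * (1 + (int q)\<^sup>2 * e)"
      using dvd by simp
    also have "e * (1 + (int q)\<^sup>2 * e) = (e * int q)\<^sup>2 - (- e)"
      by (simp add: power2_eq_square algebra_simps)
    finally have "QuadRes (int m) (- e)"
      unfolding QuadRes_def cong_iff_dvd_diff by blast
    then show ?thesis
      using nonres[of "2 * j + t"] \<open>e \<noteq> 0\<close> t unfolding e_def by simp
  qed
qed

lemma inverse_power_in_K:
  assumes "m > 0" "0 \<in> D" "1 \<in> D" "k \<ge> 1"
  shows "1 / real m ^ k \<in> K m D"
proof -
  \<comment> \<open>The only nonzero digit is a \<open>1\<close> at position \<open>k\<close>, which
    is index \<open>k - 1\<close> of the series.\<close>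
  define d where "d i = (if i = k then 1 else 0 :: nat)" for i
  have "(\<lambda>i. real (d (Suc i)) / real m ^ Suc i)
      = (\<lambda>i. if i = k - 1 then 1 / real m ^ Suc i else 0)"
    using \<open>k \<ge> 1\<close> by (auto simp: d_def fun_eq_iff)
  moreover have "(\<lambda>i. if i = k - 1 then 1 / real m ^ Suc i else 0) sums (1 / real m ^ Suc (k - 1))"
    by (rule sums_single)
  ultimately have "1 / real m ^ k = (\<Sum>i. real (d (Suc i)) / real m ^ Suc i)"
    using \<open>k \<ge> 1\<close> by (simp add: sums_iff)
  moreover have "\<forall>i\<ge>1. d i \<in> D"
    using assms by (simp add: d_def)
  ultimately show ?thesis
    unfolding K_def by blast
qed

theorem theorem1p5:
  fixes m :: nat and D :: "nat set"
  assumes "prime m" and "m \<ge> 3"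
    and "D \<subseteq> {0..<m}" and "0 \<in> D" and "1 < card D" and "card D < m"
    and "\<forall>a\<in>D - {0}. Legendre (- int a) (int m) = -1"
  shows "(1 \<notin> D \<longrightarrow> {1 / (real n)\<^sup>2 | n :: nat. n \<ge> 1} \<inter> K m D = {})
       \<and> (1 \<in> D \<longrightarrow> {1 / (real n)\<^sup>2 | n :: nat. n \<ge> 1} \<inter> K m D
                       = {1 / real m ^ (2 * l) | l :: nat. l \<ge> 1})"
proof -
  have nonres: "\<not> QuadRes (int m) (- int a)" if "a \<in> D" "a \<noteq> 0" for a
    using assms(7) that unfolding Legendre_def
    by (metis Diff_iff one_neq_neg_one singletonD zero_neq_neg_one)
  \<comment> \<open>The digit \<open>m - 1\<close> cannot occur: \<open>-(m - 1) \<equiv> 1\<close>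
    is the square of \<open>1\<close>, and \<open>m - 1\<close> is nonzero.\<close>
  have small: "Suc a < m" if "a \<in> D" for a
  proof (rule ccontr)
    assume "\<not> Suc a < m"
    with that assms(3) have a: "m = Suc a"
      by force
    have "QuadRes (int m) (- int a)"
      unfolding QuadRes_def cong_iff_dvd_diff using a by (intro exI[of _ 1]) simp
    then show False
      using nonres that a \<open>m \<ge> 3\<close> by simp
  qed
  \<comment> \<open>This serves both parts: the first conjunct empties the intersection when
    \<open>1 \<notin> D\<close>, the second gives the forward inclusion when
    \<open>1 \<in> D\<close>.\<close>
  have main: "1 \<in> D \<and> (\<exists>l\<ge>1. n = m ^ l)" if n: "n \<ge> 1" "1 / (real n)\<^sup>2 \<in> K m D" for n
  proof -
    obtain d where d: "\<And>k. k \<ge> 1 \<Longrightarrow> d k \<in> D" and "1 / (real n)\<^sup>2 = digit_value m d"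
      using n(2) unfolding K_def digit_value_def by auto
    then obtain j where "j \<ge> 1" "n = m ^ j" "d (2 * j) = 1"
      using inverse_square_digit_value[of m n d] \<open>prime m\<close> n(1) small nonres by blast
    then show ?thesis
      using d[of "2 * j"] by auto
  qed
  show ?thesis
  proof (intro conjI impI)
    assume "1 \<notin> D"
    then show "{1 / (real n)\<^sup>2 | n :: nat. n \<ge> 1} \<inter> K m D = {}"
      using main by blast
  next
    assume "1 \<in> D"
    have sq: "1 / (real (m ^ l))\<^sup>2 = 1 / real m ^ (2 * l)" for l
      by (simp add: power_mult[symmetric] mult.commute)
    have "1 / real m ^ (2 * l) \<in> {1 / (real n)\<^sup>2 | n :: nat. n \<ge> 1} \<inter> K m D" if "l \<ge> 1" for l
    proof
      show "1 / real m ^ (2 * l) \<in> {1 / (real n)\<^sup>2 | n :: nat. n \<ge> 1}"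
        using sq[of l, symmetric] \<open>m \<ge> 3\<close> by (intro CollectI exI[of _ "m ^ l"]) auto
      show "1 / real m ^ (2 * l) \<in> K m D"
        using inverse_power_in_K[of m D "2 * l"] \<open>m \<ge> 3\<close> \<open>0 \<in> D\<close> \<open>1 \<in> D\<close> that by simp
    qed
    moreover have "x \<in> {1 / real m ^ (2 * l) | l :: nat. l \<ge> 1}"
      if "x \<in> {1 / (real n)\<^sup>2 | n :: nat. n \<ge> 1} \<inter> K m D" for x
      using that main sq by blast
    ultimately show "{1 / (real n)\<^sup>2 | n :: nat. n \<ge> 1} \<inter> K m D
        = {1 / real m ^ (2 * l) | l :: nat. l \<ge> 1}"
      by blast
  qed
qed

end
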